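(* Let $\{X_n\}_{n\ge 1}$ be a sequence of chaos eigenfunctions of order $p$ with respect to the operator $-\mathbf{L}$, bounded in $L^2(E,\mu)$. Then, if $\lambda_{2p}\le 2\lambda_p$, the following two assertions are equivalent: (i) As $n\to\infty$, the sequence $\{X_n\}_{n\ge 1}$ converges in distribution (under $\mu$) to a standard Gaussian distribution. (ii) As $n\to\infty$, $m_4(X_n)-6\,m_2(X_n)+3\to 0$.
   Context: $(E,\mathcal{F},\mu)$ is a probability space and $-\mathbf{L}$ is a symmetric Markov generator with state space $E$ and invariant probability measure $\mu$; that is, $-\mathbf{L}$ is a self-adjoint linear operator on $L^2(E,\mu)$ with $-\mathbf{L}(1)=0$. It is assumed that $-\mathbf{L}$ has discrete spectrum $\{\lambda_k\}_{k\ge 0}$, ordered as $0=\lambda_0<\lambda_1<\lambda_2<\cdots$, so that $L^2(E,\mu)=\bigoplus_{k=0}^\infty\mathrm{Ker}(\mathbf{L}+\lambda_k\mathbf{Id})$ (orthogonal sum), where $\mathbf{Id}$ is the identity operator. The carré du champ operator is $\Gamma(X,Y)=\frac12(\mathbf{L}(XY)-X\mathbf{L}Y-Y\mathbf{L}X)$, and $\Gamma(X)=\Gamma(X,X)$. $\mathbf{L}$ is assumed diffusive: for any test function $\phi\in\mathcal{C}^\infty(\mathbb{R})$ and any $X\in L^2(E,\mu)$, $\mathbf{L}\phi(X)=\phi'(X)\mathbf{L}X+\phi''(X)\Gamma(X)$; equivalently, $\Gamma$ is a derivation in the sense that $\Gamma(\phi(X),X)=\phi'(X)\Gamma(X)$.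 The eigenspaces are assumed hypercontractive; in particular, on each eigenspace $\mathrm{Ker}(\mathbf{L}+\lambda_k\mathbf{Id})$, a sequence bounded in $L^2(E,\mu)$ is bounded in $L^r(E,\mu)$ for every $r\ge 1$. Chaos eigenfunction: an eigenfunction $X$ of $-\mathbf{L}$ with eigenvalue $\lambda_p$ (i.e. $\mathbf{L}X=-\lambda_pX$) is called a chaos eigenfunction of order $p$ if and only if $X^2\in\bigoplus_{k=0}^{2p}\mathrm{Ker}(\mathbf{L}+\lambda_k\mathbf{Id})$. Moments: $m_k(X)=\int_E X^k\,d\mu$.
   Formalization: The order p is required to be at least 1: for p = 0 the claim fails, since the constant sequence X_n = c with c² = 3 + √6 satisfies (ii) but does not converge to a Gaussian. *)

theory Defs
  imports "HOL-Probability.Probability"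
begin

section \<open>Operators on the real Hilbert space of square-integrable functions\<close>

text \<open>
  Elements of \<open>L\<^sup>2(E,\<mu>)\<close> are represented by functions, identified when they agree almost
  everywhere; hence all operator identities below are almost-everywhere identities.
\<close>

definition L2 :: "'a measure \<Rightarrow> ('a \<Rightarrow> real) set" where
  "L2 M = {X \<in> borel_measurable M. integrable M (\<lambda>x. (X x)\<^sup>2)}"

definition L2_inner :: "'a measure \<Rightarrow> ('a \<Rightarrow> real) \<Rightarrow> ('a \<Rightarrow> real) \<Rightarrow> real" where
  "L2_inner M X Y = (\<integral>x. X x * Y x \<partial>M)"

definition L2_norm :: "'a measure \<Rightarrow> ('a \<Rightarrow> real) \<Rightarrow> real" where
  "L2_norm M X = sqrt (L2_inner M X X)"

definition bounded_in_Lr :: "'a measure \<Rightarrow> real \<Rightarrow> (nat \<Rightarrow> 'a \<Rightarrow> real) \<Rightarrow> bool" where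
  "bounded_in_Lr M r X \<longleftrightarrow>
     (\<exists>C. \<forall>n. X n \<in> borel_measurable M \<and> integrable M (\<lambda>x. \<bar>X n x\<bar> powr r) \<and>
              (\<integral>x. \<bar>X n x\<bar> powr r \<partial>M) \<le> C)"

text \<open>
  A possibly unbounded linear operator is given by its domain \<open>D\<close> and a map \<open>L\<close>; the values of
  \<open>L\<close> outside \<open>D\<close> are irrelevant.
\<close>

locale L2_operator = prob_space M
  for M :: "'a measure" and D :: "('a \<Rightarrow> real) set"
    and L :: "('a \<Rightarrow> real) \<Rightarrow> ('a \<Rightarrow> real)" +
  assumes dom_subset: "D \<subseteq> L2 M"
    and range_L2: "X \<in> D \<Longrightarrow> L X \<in> L2 M"
    and dom_AE_cong: "X \<in> D \<Longrightarrow> Y \<in> borel_measurable M \<Longrightarrow> (AE x in M. X x = Y x) \<Longrightarrow> Y \<in> D"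
    and L_AE_cong: "X \<in> D \<Longrightarrow> Y \<in> D \<Longrightarrow> (AE x in M. X x = Y x) \<Longrightarrow> (AE x in M. L X x = L Y x)"
    and dom_add: "X \<in> D \<Longrightarrow> Y \<in> D \<Longrightarrow> (\<lambda>x. X x + Y x) \<in> D"
    and L_add: "X \<in> D \<Longrightarrow> Y \<in> D \<Longrightarrow> (AE x in M. L (\<lambda>x. X x + Y x) x = L X x + L Y x)"
    and dom_scale: "X \<in> D \<Longrightarrow> (\<lambda>x. c * X x) \<in> D"
    and L_scale: "X \<in> D \<Longrightarrow> (AE x in M. L (\<lambda>x. c * X x) x = c * L X x)"

locale symmetric_markov_generator = L2_operator M D L
  for M :: "'a measure" and D :: "('a \<Rightarrow> real) set"
    and L :: "('a \<Rightarrow> real) \<Rightarrow> ('a \<Rightarrow> real)" +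
  assumes dom_dense: "X \<in> L2 M \<Longrightarrow> e > 0 \<Longrightarrow> \<exists>Y\<in>D. L2_norm M (\<lambda>x. X x - Y x) < e"
    and symmetric: "X \<in> D \<Longrightarrow> Y \<in> D \<Longrightarrow> L2_inner M (L X) Y = L2_inner M X (L Y)"
    \<comment> \<open>the domain of the adjoint is contained in \<open>D\<close>; with symmetry, \<open>L\<close> is self-adjoint\<close>
    and adjoint_dom: "X \<in> L2 M \<Longrightarrow> Y \<in> L2 M \<Longrightarrow>
           (\<And>Z. Z \<in> D \<Longrightarrow> L2_inner M X (L Z) = L2_inner M Y Z) \<Longrightarrow> X \<in> D"
    and one_dom: "(\<lambda>x. 1) \<in> D"
    and L_one: "AE x in M. L (\<lambda>x. 1) x = 0"

text \<open>
  The spectrum of \<open>-L\<close>: the complement of the set of those \<open>z\<close> for which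
  \<open>-L - z Id\<close> is a bijection from \<open>D\<close> onto \<open>L\<^sup>2\<close> with bounded inverse. For a self-adjoint operator
  the spectrum is real, so real \<open>z\<close> suffice.
\<close>

definition neg_spectrum ::
  "'a measure \<Rightarrow> ('a \<Rightarrow> real) set \<Rightarrow> (('a \<Rightarrow> real) \<Rightarrow> ('a \<Rightarrow> real)) \<Rightarrow> real set" where
  "neg_spectrum M D L = - {z. \<exists>C. \<forall>Y\<in>L2 M. \<exists>X\<in>D.
      (AE x in M. - L X x - z * X x = Y x) \<and> L2_norm M X \<le> C * L2_norm M Y \<and>
      (\<forall>X'\<in>D. (AE x in M. - L X' x - z * X' x = Y x) \<longrightarrow> (AE x in M. X' x = X x))}"

text \<open>\<open>Ker(L + l Id)\<close>\<close>

definition eigenspace ::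
  "'a measure \<Rightarrow> ('a \<Rightarrow> real) set \<Rightarrow> (('a \<Rightarrow> real) \<Rightarrow> ('a \<Rightarrow> real)) \<Rightarrow> real \<Rightarrow> ('a \<Rightarrow> real) set"
  where
  "eigenspace M D L l = {X \<in> D. AE x in M. L X x + l * X x = 0}"

definition orthogonal_sum_L2 :: "'a measure \<Rightarrow> (nat \<Rightarrow> ('a \<Rightarrow> real) set) \<Rightarrow> bool" where
  "orthogonal_sum_L2 M H \<longleftrightarrow>
     (\<forall>j k. j \<noteq> k \<longrightarrow> (\<forall>X\<in>H j. \<forall>Y\<in>H k. L2_inner M X Y = 0)) \<and>
     (\<forall>X\<in>L2 M. \<exists>Y. (\<forall>k. Y k \<in> H k) \<and>
        (\<lambda>n. L2_norm M (\<lambda>x. X x - (\<Sum>k<n. Y k x))) \<longlonglongrightarrow> 0)"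

definition partial_sum_L2 ::
  "'a measure \<Rightarrow> (nat \<Rightarrow> ('a \<Rightarrow> real) set) \<Rightarrow> nat \<Rightarrow> ('a \<Rightarrow> real) set" where
  "partial_sum_L2 M H n =
     {X \<in> L2 M. \<exists>Y. (\<forall>k\<le>n. Y k \<in> H k) \<and> (AE x in M. X x = (\<Sum>k\<le>n. Y k x))}"


section \<open>Diffusive Markov generators\<close>

definition carre_du_champ ::
  "(('a \<Rightarrow> real) \<Rightarrow> ('a \<Rightarrow> real)) \<Rightarrow> ('a \<Rightarrow> real) \<Rightarrow> ('a \<Rightarrow> real) \<Rightarrow> 'a \<Rightarrow> real" where
  "carre_du_champ L X Y = (\<lambda>x. (L (\<lambda>x. X x * Y x) x - X x * L Y x - Y x * L X x) / 2)"

definition smooth_real :: "(real \<Rightarrow> real) \<Rightarrow> bool" where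
  "smooth_real \<phi> \<longleftrightarrow> (\<forall>k x. (deriv ^^ k) \<phi> field_differentiable at x)"

text \<open>
  Since \<open>L\<close> is unbounded, the diffusion identity is required whenever its right-hand side
  is a well-defined element of \<open>L\<^sup>2\<close>: \<open>X\<close> and \<open>X\<^sup>2\<close> lie in the domain (so that \<open>L X\<close> and
  \<open>\<Gamma>(X)\<close> exist) and \<open>\<phi>(X)\<close> and the right-hand side are square-integrable. The identity
  then includes that \<open>\<phi>(X)\<close> lies in the domain.
\<close>

definition diffusive ::
  "'a measure \<Rightarrow> ('a \<Rightarrow> real) set \<Rightarrow> (('a \<Rightarrow> real) \<Rightarrow> ('a \<Rightarrow> real)) \<Rightarrow> bool" where
  "diffusive M D L \<longleftrightarrow>
     (\<forall>\<phi> X. let R = (\<lambda>x. deriv \<phi> (X x) * L X x + deriv (deriv \<phi>) (X x) * carre_du_champ L X X x) in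
        smooth_real \<phi> \<and> X \<in> D \<and> (\<lambda>x. X x * X x) \<in> D \<and> (\<lambda>x. \<phi> (X x)) \<in> L2 M \<and> R \<in> L2 M \<longrightarrow>
        (\<lambda>x. \<phi> (X x)) \<in> D \<and> (AE x in M. L (\<lambda>x. \<phi> (X x)) x = R x))"

definition hypercontractive :: "'a measure \<Rightarrow> ('a \<Rightarrow> real) set \<Rightarrow> bool" where
  "hypercontractive M H \<longleftrightarrow>
     (\<forall>X. (\<forall>n. X n \<in> H) \<longrightarrow> bounded_in_Lr M 2 X \<longrightarrow> (\<forall>r\<ge>1. bounded_in_Lr M r X))"

locale markov_diffusion_generator = symmetric_markov_generator M D L
  for M :: "'a measure" and D :: "('a \<Rightarrow> real) set"
    and L :: "('a \<Rightarrow> real) \<Rightarrow> ('a \<Rightarrow> real)" and lam :: "nat \<Rightarrow> real" +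
  assumes lam_0: "lam 0 = 0"
    and lam_strict_mono: "strict_mono lam"
    and discrete_spectrum: "neg_spectrum M D L = range lam"
    and decomposition: "orthogonal_sum_L2 M (\<lambda>k. eigenspace M D L (lam k))"
    and diffusive: "diffusive M D L"
    and hypercontractive: "hypercontractive M (eigenspace M D L (lam k))"


section \<open>Chaos eigenfunctions and moments\<close>

definition chaos_eigenfunction ::
  "'a measure \<Rightarrow> ('a \<Rightarrow> real) set \<Rightarrow> (('a \<Rightarrow> real) \<Rightarrow> ('a \<Rightarrow> real)) \<Rightarrow> (nat \<Rightarrow> real) \<Rightarrow> nat \<Rightarrow>
   ('a \<Rightarrow> real) \<Rightarrow> bool" where
  "chaos_eigenfunction M D L lam p X \<longleftrightarrow>
     X \<in> eigenspace M D L (lam p) \<and>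
     (\<lambda>x. (X x)\<^sup>2) \<in> partial_sum_L2 M (\<lambda>k. eigenspace M D L (lam k)) (2 * p)"

definition moment :: "'a measure \<Rightarrow> nat \<Rightarrow> ('a \<Rightarrow> real) \<Rightarrow> real" where
  "moment M k X = (\<integral>x. (X x) ^ k \<partial>M)"

end

theory Submission
  imports Defs
begin

text \<open>
  Write \<open>\<lambda> = lam p\<close> and \<open>\<Gamma> = \<Gamma>(X)\<close> for a chaos eigenfunction \<open>X\<close> of order \<open>p\<close>. Applying the
  diffusion identity to \<open>\<phi>(X)\<close> and integrating gives \<open>E[\<phi>''(X) \<Gamma>] = \<lambda> E[X \<phi>'(X)]\<close>. If \<open>\<Gamma>\<close> were
  the constant \<open>\<lambda>\<close>, this would be Stein's equation for the standard Gaussian law, so everything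
  hinges on how far \<open>\<Gamma> / \<lambda>\<close> is from \<open>1\<close> in \<open>L\<^sup>2\<close>. The fourth moment controls this distance:
  \<open>E[(\<Gamma> / \<lambda> - 1)\<^sup>2] \<le> (m\<^sub>4(X) - 6 m\<^sub>2(X) + 3) / 3\<close> (\<open>fourth_moment_bound\<close>).

  To see this, expand \<open>X\<^sup>2 = \<Sum>k\<le>2p. Y k\<close> along the eigenspaces. Since \<open>2 \<Gamma> = (L + 2 \<lambda>) X\<^sup>2\<close>, the
  carre du champ is the combination of the \<open>Y k\<close> with the coefficients \<open>c k = \<lambda> - lam k / 2\<close>,
  which lie in \<open>[0, \<lambda>]\<close> because \<open>0 \<le> lam k \<le> lam (2p) \<le> 2 \<lambda>\<close>. Hence \<open>(c k)\<^sup>2 \<le> \<lambda> c k\<close>, and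
  orthogonality turns this into \<open>E[\<Gamma>\<^sup>2] \<le> \<lambda> E[X\<^sup>2 \<Gamma>]\<close>. The test function \<open>x\<^sup>4\<close> evaluates the right-hand
  side as \<open>\<lambda>\<^sup>2 m\<^sub>4(X) / 3\<close>, and \<open>E[\<Gamma>] = \<lambda> m\<^sub>2(X)\<close>; expanding the square gives the bound.

  From the moment condition to normality: the test functions \<open>cos (t x)\<close> and \<open>sin (t x)\<close> produce a
  perturbed form of the differential equation \<open>\<phi>' = - t \<phi>\<close> of the Gaussian characteristic
  function, whose solution is within \<open>t\<^sup>2 E\<bar>\<Gamma> / \<lambda> - 1\<bar>\<close> of \<open>exp (- t\<^sup>2 / 2)\<close>
  (\<open>char_near_gaussian_of_stein_identity\<close>); Levy's continuity theorem concludes. In the other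
  direction, hypercontractivity bounds all moments uniformly, so that convergence in law entails
  \<open>m\<^sub>2 \<rightarrow> 1\<close> and \<open>m\<^sub>4 \<rightarrow> 3\<close> (\<open>weak_conv_imp_integral_conv\<close>).
\<close>

section \<open>Square-integrable functions\<close>

lemma abs_mult_le_squares: "\<bar>a * b\<bar> \<le> a\<^sup>2 + (b::real)\<^sup>2"
proof -
  have "2 * (\<bar>a\<bar> * \<bar>b\<bar>) \<le> a\<^sup>2 + b\<^sup>2"
    using sum_squares_bound[of "\<bar>a\<bar>" "\<bar>b\<bar>"] by simp
  moreover have "0 \<le> \<bar>a\<bar> * \<bar>b\<bar>" by simp
  ultimately show ?thesis unfolding abs_mult by linarith
qed

lemma L2_mult_integrable:
  assumes "X \<in> L2 M" "Y \<in> L2 M"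
  shows "integrable M (\<lambda>x. X x * Y x)"
proof (rule Bochner_Integration.integrable_bound)
  show "integrable M (\<lambda>x. (X x)\<^sup>2 + (Y x)\<^sup>2)"
    using assms by (auto simp: L2_def)
  show "AE x in M. norm (X x * Y x) \<le> norm ((X x)\<^sup>2 + (Y x)\<^sup>2)"
    using abs_mult_le_squares by (simp del: abs_mult)
qed (use assms in \<open>auto simp: L2_def\<close>)

lemma L2_mult_left:
  assumes "X \<in> L2 M" shows "(\<lambda>x. c * X x) \<in> L2 M"
  using assms by (auto simp: L2_def power_mult_distrib)

lemma L2_add:
  assumes "X \<in> L2 M" "Y \<in> L2 M"
  shows "(\<lambda>x. X x + Y x) \<in> L2 M"
proof -
  have "integrable M (\<lambda>x. (X x)\<^sup>2 + (Y x)\<^sup>2 + 2 * (X x * Y x))"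
    using assms L2_mult_integrable[OF assms] by (auto simp: L2_def)
  then show ?thesis
    using assms by (auto simp: L2_def power2_sum algebra_simps)
qed

lemma L2_sum:
  assumes "\<And>k. k \<in> A \<Longrightarrow> Y k \<in> L2 M"
  shows "(\<lambda>x. \<Sum>k\<in>A. Y k x) \<in> L2 M"
  using assms
proof (induction A rule: infinite_finite_induct)
  case (insert a A)
  then show ?case using L2_add[of "Y a" M "\<lambda>x. \<Sum>k\<in>A. Y k x"] by simp
qed (auto simp: L2_def)

lemma L2_bounded_mult:
  assumes "X \<in> L2 M" and [measurable]: "f \<in> borel_measurable M" and b: "\<And>x. \<bar>f x\<bar> \<le> c"
  shows "(\<lambda>x. f x * X x) \<in> L2 M"
proof -
  have [measurable]: "X \<in> borel_measurable M" using assms by (simp add: L2_def)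
  have "integrable M (\<lambda>x. (f x * X x)\<^sup>2)"
  proof (rule Bochner_Integration.integrable_bound)
    show "integrable M (\<lambda>x. c\<^sup>2 * (X x)\<^sup>2)" using assms by (simp add: L2_def)
    show "AE x in M. norm ((f x * X x)\<^sup>2) \<le> norm (c\<^sup>2 * (X x)\<^sup>2)"
    proof (intro AE_I2)
      fix x
      have "(f x)\<^sup>2 \<le> c\<^sup>2" using b[of x] by (simp add: abs_le_square_iff[symmetric] abs_le_iff)
      then show "norm ((f x * X x)\<^sup>2) \<le> norm (c\<^sup>2 * (X x)\<^sup>2)"
        by (simp add: power_mult_distrib mult_right_mono)
    qed
  qed simp
  then show ?thesis by (simp add: L2_def)
qed

lemma L2_AE_cong:
  assumes "X \<in> L2 M" "Y \<in> borel_measurable M" "AE x in M. X x = Y x"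
  shows "Y \<in> L2 M"
proof -
  have "integrable M (\<lambda>x. (Y x)\<^sup>2)"
    by (rule integrable_cong_AE_imp[of M "\<lambda>x. (X x)\<^sup>2"]) (use assms in \<open>auto simp: L2_def\<close>)
  then show ?thesis using assms by (simp add: L2_def)
qed

text \<open>
  The variance of \<open>\<bar>X\<bar>\<close> is nonnegative.
\<close>

lemma (in prob_space) expectation_abs_le_sqrt:
  assumes "X \<in> L2 M"
  shows "expectation (\<lambda>x. \<bar>X x\<bar>) \<le> sqrt (expectation (\<lambda>x. (X x)\<^sup>2))"
proof -
  have one: "(\<lambda>x. 1) \<in> L2 M" by (simp add: L2_def)
  have "integrable M X" using L2_mult_integrable[OF assms one] by simp
  then have i: "integrable M (\<lambda>x. \<bar>X x\<bar>)" by simp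
  have "variance (\<lambda>x. \<bar>X x\<bar>) = expectation (\<lambda>x. (X x)\<^sup>2) - (expectation (\<lambda>x. \<bar>X x\<bar>))\<^sup>2"
    using variance_eq[OF i] assms by (simp add: L2_def)
  then have "(expectation (\<lambda>x. \<bar>X x\<bar>))\<^sup>2 \<le> expectation (\<lambda>x. (X x)\<^sup>2)"
    using variance_positive[of "\<lambda>x. \<bar>X x\<bar>"] by linarith
  then show ?thesis by (rule real_le_rsqrt)
qed

section \<open>Smooth test functions\<close>

text \<open>
  Smoothness is shown coinductively: it suffices to exhibit a set of functions that is closed
  under differentiation.
\<close>

lemma smooth_realI:
  assumes "f \<in> S" "\<And>g. g \<in> S \<Longrightarrow> \<exists>h\<in>S. \<forall>x. (g has_field_derivative h x) (at x)"
  shows "smooth_real f"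
proof -
  have "(deriv ^^ k) f \<in> S" for k
  proof (induction k)
    case (Suc k)
    obtain h where "h \<in> S" "\<forall>x. ((deriv ^^ k) f has_field_derivative h x) (at x)"
      using assms(2)[OF Suc] by blast
    moreover from this(2) have "deriv ((deriv ^^ k) f) = h" by (auto intro: DERIV_imp_deriv)
    ultimately show ?case by simp
  qed (use assms in simp)
  then show ?thesis unfolding smooth_real_def field_differentiable_def using assms(2) by blast
qed

lemma deriv_trig:
  fixes a b t :: real
  shows "deriv (\<lambda>x. a * cos (t * x) + b * sin (t * x)) =
         (\<lambda>x. (b * t) * cos (t * x) + (- a * t) * sin (t * x))"
  by (intro ext DERIV_imp_deriv) (auto intro!: derivative_eq_intros)

lemma smooth_real_trig:
  fixes a b t :: real
  shows "smooth_real (\<lambda>x. a * cos (t * x) + b * sin (t * x))"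
proof (rule smooth_realI[where S = "{\<lambda>x. a * cos (t * x) + b * sin (t * x) |a b. True}"])
  fix g assume "g \<in> {\<lambda>x. a * cos (t * x) + b * sin (t * x) |a b. True}"
  then obtain a b where g: "g = (\<lambda>x. a * cos (t * x) + b * sin (t * x))" by blast
  have "\<forall>x. (g has_field_derivative (b * t) * cos (t * x) + (- a * t) * sin (t * x)) (at x)"
    unfolding g by (auto intro!: derivative_eq_intros)
  then show "\<exists>h\<in>{\<lambda>x. a * cos (t * x) + b * sin (t * x) |a b. True}. \<forall>x. (g has_field_derivative h x) (at x)"
    by (intro bexI[of _ "\<lambda>x. (b * t) * cos (t * x) + (- a * t) * sin (t * x)"]) blast+
qed blast

lemma smooth_real_poly: "smooth_real (poly p)"
  by (rule smooth_realI[where S = "range poly"]) (auto intro: poly_DERIV)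

lemma power4_eq_poly: "(\<lambda>x::real. x ^ 4) = poly (monom 1 4)"
  by (auto simp: poly_monom)

section \<open>Operators on \<open>L\<^sup>2\<close>\<close>

lemma (in L2_operator) dom_L2: "X \<in> D \<Longrightarrow> X \<in> L2 M"
  using dom_subset by blast

lemma (in L2_operator) dom_sum:
  assumes "\<And>k. k \<le> (n::nat) \<Longrightarrow> Y k \<in> D"
  shows "(\<lambda>x. \<Sum>k\<le>n. Y k x) \<in> D \<and> (AE x in M. L (\<lambda>x. \<Sum>k\<le>n. Y k x) x = (\<Sum>k\<le>n. L (Y k) x))"
  using assms
proof (induction n)
  case (Suc n)
  then have IH: "(\<lambda>x. \<Sum>k\<le>n. Y k x) \<in> D"
    "AE x in M. L (\<lambda>x. \<Sum>k\<le>n. Y k x) x = (\<Sum>k\<le>n. L (Y k) x)" by auto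
  have Y: "Y (Suc n) \<in> D" using Suc.prems by simp
  show ?case using dom_add[OF IH(1) Y] L_add[OF IH(1) Y] IH(2) by (auto elim: AE_mp)
qed simp

text \<open>
  The measure is invariant: move \<open>L\<close> by symmetry onto the constant \<open>1\<close>, which it annihilates.
\<close>

lemma (in symmetric_markov_generator) expectation_L:
  assumes "X \<in> D" shows "expectation (L X) = 0"
proof -
  have "expectation (L X) = L2_inner M (L X) (\<lambda>x. 1)" by (simp add: L2_inner_def)
  also have "\<dots> = L2_inner M X (L (\<lambda>x. 1))" using symmetric[OF assms one_dom] .
  also have "\<dots> = expectation (\<lambda>x. 0)"
    unfolding L2_inner_def
    using L_one range_L2[OF one_dom] dom_L2[OF assms]
    by (intro integral_cong_AE) (auto simp: L2_def)
  finally show ?thesis by simp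
qed

lemma (in symmetric_markov_generator) carre_du_champ_borel_measurable:
  assumes "X \<in> D" "(\<lambda>x. X x * X x) \<in> D"
  shows "carre_du_champ L X X \<in> borel_measurable M"
proof -
  have [measurable]: "X \<in> borel_measurable M" "L X \<in> borel_measurable M"
    "L (\<lambda>x. X x * X x) \<in> borel_measurable M"
    using dom_L2[OF assms(1)] range_L2[OF assms(1)] range_L2[OF assms(2)] by (auto simp: L2_def)
  show ?thesis unfolding carre_du_champ_def by measurable
qed

section \<open>Integrated diffusion identity and spectral expansion\<close>

text \<open>
  Right-hand side of the chain rule for \<open>L \<phi>(X)\<close>, integrated against the invariant measure. All
  information about the law of \<open>X\<close> used below is extracted from this identity by a choice of \<open>\<phi>\<close>.
\<close>

lemma (in markov_diffusion_generator) diffusion_expectation: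
  assumes "smooth_real \<phi>" "X \<in> D" "(\<lambda>x. X x * X x) \<in> D" "(\<lambda>x. \<phi> (X x)) \<in> L2 M"
    and R: "(\<lambda>x. deriv \<phi> (X x) * L X x + deriv (deriv \<phi>) (X x) * carre_du_champ L X X x) \<in> L2 M"
  shows "expectation (\<lambda>x. deriv \<phi> (X x) * L X x + deriv (deriv \<phi>) (X x) * carre_du_champ L X X x) = 0"
    (is "expectation ?R = 0")
proof -
  have d: "(\<lambda>x. \<phi> (X x)) \<in> D" "AE x in M. L (\<lambda>x. \<phi> (X x)) x = ?R x"
    using diffusive assms unfolding diffusive_def Let_def by blast+
  have "expectation ?R = expectation (L (\<lambda>x. \<phi> (X x)))"
    using d(2) range_L2[OF d(1)] R by (intro integral_cong_AE) (auto simp: L2_def)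
  then show ?thesis using expectation_L[OF d(1)] by simp
qed

lemma eigenspace_dom: "X \<in> eigenspace M D L l \<Longrightarrow> X \<in> D"
  by (simp add: eigenspace_def)

lemma eigenspace_AE: "X \<in> eigenspace M D L l \<Longrightarrow> AE x in M. L X x = - l * X x"
  by (auto simp: eigenspace_def elim!: AE_mp)

text \<open>
  Hypercontractivity speaks of bounded sequences; a constant sequence turns it into the statement
  that eigenfunctions have moments of all orders.
\<close>

lemma (in markov_diffusion_generator) eigenspace_power_L2:
  assumes X: "X \<in> eigenspace M D L (lam k)"
  shows "(\<lambda>x. X x ^ n) \<in> L2 M"
proof (cases "n = 0")
  case False
  have L2: "X \<in> L2 M" using dom_L2 eigenspace_dom[OF X] .
  have sq: "\<bar>y\<bar> powr real (2 * n) = (y ^ n)\<^sup>2" for y :: real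
    using False by (subst powr_realpow') (auto simp: power_even_abs power_mult[symmetric] mult.commute)
  have sq2: "\<bar>y\<bar> powr 2 = y\<^sup>2" for y :: real
    by (simp add: powr_numeral)
  have "bounded_in_Lr M 2 (\<lambda>i. X)"
    using L2 unfolding bounded_in_Lr_def sq2 L2_def by auto
  then have "bounded_in_Lr M (real (2 * n)) (\<lambda>i. X)"
    using hypercontractive X False unfolding hypercontractive_def by fastforce
  then show ?thesis unfolding bounded_in_Lr_def sq L2_def by auto
qed (simp add: L2_def)

lemma (in markov_diffusion_generator) orthogonal_expansion:
  assumes Y: "\<And>k. k \<le> n \<Longrightarrow> Y k \<in> eigenspace M D L (lam k)"
  shows "expectation (\<lambda>x. (\<Sum>k\<le>n. a k * Y k x) * (\<Sum>k\<le>n. b k * Y k x)) =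
         (\<Sum>k\<le>n. a k * b k * expectation (\<lambda>x. (Y k x)\<^sup>2))"
proof -
  have L2: "Y k \<in> L2 M" if "k \<le> n" for k using Y[OF that] eigenspace_dom dom_L2 by blast
  have orth: "expectation (\<lambda>x. Y i x * Y j x) = (if i = j then expectation (\<lambda>x. (Y i x)\<^sup>2) else 0)"
    if "i \<le> n" "j \<le> n" for i j
    using decomposition Y[OF that(1)] Y[OF that(2)]
    unfolding orthogonal_sum_L2_def L2_inner_def by (auto simp: power2_eq_square)
  have int: "integrable M (\<lambda>x. a i * b j * (Y i x * Y j x))" if "i \<le> n" "j \<le> n" for i j
    by (intro integrable_mult_right L2_mult_integrable L2 that)
  have "expectation (\<lambda>x. (\<Sum>k\<le>n. a k * Y k x) * (\<Sum>k\<le>n. b k * Y k x)) =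
        expectation (\<lambda>x. \<Sum>i\<le>n. \<Sum>j\<le>n. a i * b j * (Y i x * Y j x))"
    by (simp add: sum_product algebra_simps)
  also have "\<dots> = (\<Sum>i\<le>n. expectation (\<lambda>x. \<Sum>j\<le>n. a i * b j * (Y i x * Y j x)))"
    by (intro Bochner_Integration.integral_sum Bochner_Integration.integrable_sum int) auto
  also have "\<dots> = (\<Sum>i\<le>n. \<Sum>j\<le>n. expectation (\<lambda>x. a i * b j * (Y i x * Y j x)))"
    by (intro sum.cong refl Bochner_Integration.integral_sum int) auto
  also have "\<dots> = (\<Sum>i\<le>n. \<Sum>j\<le>n. a i * b j * expectation (\<lambda>x. Y i x * Y j x))"
    by (intro sum.cong refl integral_mult_right_zero)
  also have "\<dots> = (\<Sum>i\<le>n. \<Sum>j\<le>n. if i = j then a i * b j * expectation (\<lambda>x. (Y i x)\<^sup>2) else 0)"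
    by (intro sum.cong) (auto simp: orth)
  also have "\<dots> = (\<Sum>k\<le>n. a k * b k * expectation (\<lambda>x. (Y k x)\<^sup>2))"
    by (intro sum.cong) auto
  finally show ?thesis .
qed

section \<open>The carre du champ of a chaos eigenfunction\<close>

lemma chaos_eigenfunction_eigenspace:
  "chaos_eigenfunction M D L lam p X \<Longrightarrow> X \<in> eigenspace M D L (lam p)"
  by (simp add: chaos_eigenfunction_def)

text \<open>
  On an eigenfunction \<open>2 \<Gamma>(X) = (L + 2 \<lambda>) X\<^sup>2\<close> with \<open>\<lambda> = lam p\<close>, and \<open>L\<close> acts on the
  \<open>k\<close>-th component of \<open>X\<^sup>2\<close> as multiplication by \<open>- lam k\<close>.
\<close>

lemma (in markov_diffusion_generator) chaos_carre_du_champ_expansion: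
  assumes X: "chaos_eigenfunction M D L lam p X"
  shows "(\<lambda>x. X x * X x) \<in> D"
    and "\<exists>Y. (\<forall>k\<le>2 * p. Y k \<in> eigenspace M D L (lam k)) \<and>
           (AE x in M. (X x)\<^sup>2 = (\<Sum>k\<le>2 * p. Y k x)) \<and>
           (AE x in M. carre_du_champ L X X x = (\<Sum>k\<le>2 * p. (2 * lam p - lam k) / 2 * Y k x))"
proof -
  note E = chaos_eigenfunction_eigenspace[OF X]
  obtain Y where Y: "\<And>k. k \<le> 2 * p \<Longrightarrow> Y k \<in> eigenspace M D L (lam k)"
    and sq: "AE x in M. (X x)\<^sup>2 = (\<Sum>k\<le>2 * p. Y k x)"
    using X unfolding chaos_eigenfunction_def partial_sum_L2_def by auto
  have XD: "X \<in> D" by (rule eigenspace_dom[OF E])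
  have [measurable]: "X \<in> borel_measurable M" using dom_L2[OF XD] by (simp add: L2_def)
  have YD: "Y k \<in> D" if "k \<le> 2 * p" for k using eigenspace_dom[OF Y[OF that]] .
  have S: "(\<lambda>x. \<Sum>k\<le>2 * p. Y k x) \<in> D"
    "AE x in M. L (\<lambda>x. \<Sum>k\<le>2 * p. Y k x) x = (\<Sum>k\<le>2 * p. L (Y k) x)"
    using dom_sum[of "2 * p" Y, OF YD] by blast+
  show XX: "(\<lambda>x. X x * X x) \<in> D"
    by (rule dom_AE_cong[OF S(1)]) (use sq in \<open>auto simp: power2_eq_square\<close>)
  have LXX: "AE x in M. L (\<lambda>x. X x * X x) x = L (\<lambda>x. \<Sum>k\<le>2 * p. Y k x) x"
    by (rule L_AE_cong[OF XX S(1)]) (use sq in \<open>auto simp: power2_eq_square\<close>)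
  have LY: "AE x in M. \<forall>k\<in>{..2 * p}. L (Y k) x = - lam k * Y k x"
    by (rule AE_finite_allI) (simp, rule eigenspace_AE[OF Y], simp)
  have "AE x in M. carre_du_champ L X X x = (\<Sum>k\<le>2 * p. (2 * lam p - lam k) / 2 * Y k x)"
    using LXX S(2) LY eigenspace_AE[OF E] sq
  proof eventually_elim
    case (elim x)
    have "L (\<lambda>x. X x * X x) x = (\<Sum>k\<le>2 * p. - lam k * Y k x)"
      unfolding elim(1,2) by (rule sum.cong) (use elim(3) in auto)
    then have "carre_du_champ L X X x = ((\<Sum>k\<le>2 * p. - lam k * Y k x) + 2 * lam p * (X x)\<^sup>2) / 2"
      unfolding carre_du_champ_def elim(4) by (simp add: power2_eq_square)
    also have "\<dots> = (\<Sum>k\<le>2 * p. (- lam k * Y k x + 2 * lam p * Y k x) / 2)"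
      unfolding elim(5) sum_distrib_left sum.distrib[symmetric] sum_divide_distrib ..
    also have "\<dots> = (\<Sum>k\<le>2 * p. (2 * lam p - lam k) / 2 * Y k x)"
      by (rule sum.cong) (simp_all add: left_diff_distrib)
    finally show ?case .
  qed
  with Y sq show "\<exists>Y. (\<forall>k\<le>2 * p. Y k \<in> eigenspace M D L (lam k)) \<and>
           (AE x in M. (X x)\<^sup>2 = (\<Sum>k\<le>2 * p. Y k x)) \<and>
           (AE x in M. carre_du_champ L X X x = (\<Sum>k\<le>2 * p. (2 * lam p - lam k) / 2 * Y k x))"
    by blast
qed

text \<open>
  These integrability facts admit the test functions \<open>cos\<close>, \<open>sin\<close> and \<open>x\<^sup>4\<close> into the diffusion
  identity, which requires a square-integrable right-hand side. They follow from the expansion,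
  as each component has moments of all orders.
\<close>

lemma (in markov_diffusion_generator) carre_du_champ_L2:
  assumes X: "chaos_eigenfunction M D L lam p X"
  shows "carre_du_champ L X X \<in> L2 M" "(\<lambda>x. (X x)\<^sup>2 * carre_du_champ L X X x) \<in> L2 M"
proof -
  note E = chaos_eigenfunction_eigenspace[OF X]
  note XD = eigenspace_dom[OF E] and XX = chaos_carre_du_champ_expansion(1)[OF X]
  obtain Y where Y: "\<And>k. k \<le> 2 * p \<Longrightarrow> Y k \<in> eigenspace M D L (lam k)"
    and \<Gamma>: "AE x in M. carre_du_champ L X X x = (\<Sum>k\<le>2 * p. (2 * lam p - lam k) / 2 * Y k x)"
    using chaos_carre_du_champ_expansion(2)[OF X] by blast
  note [measurable] = carre_du_champ_borel_measurable[OF XD XX]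
  have [measurable]: "X \<in> borel_measurable M" using dom_L2[OF XD] by (simp add: L2_def)
  have Y2: "Y k \<in> L2 M" if "k \<le> 2 * p" for k using dom_L2[OF eigenspace_dom[OF Y[OF that]]] .
  have "(\<lambda>x. \<Sum>k\<le>2 * p. (2 * lam p - lam k) / 2 * Y k x) \<in> L2 M"
    by (intro L2_sum L2_mult_left Y2) simp
  then show "carre_du_champ L X X \<in> L2 M"
    by (rule L2_AE_cong) (use \<Gamma> in auto)
  have XY: "(\<lambda>x. (X x)\<^sup>2 * Y k x) \<in> L2 M" if k: "k \<le> 2 * p" for k
  proof -
    have "integrable M (\<lambda>x. X x ^ 4 * Y k x ^ 2)"
      using L2_mult_integrable[OF eigenspace_power_L2[OF E, of 4] eigenspace_power_L2[OF Y[OF k], of 2]] .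
    then have "integrable M (\<lambda>x. ((X x)\<^sup>2 * Y k x)\<^sup>2)"
      by (simp add: power_mult_distrib power_mult[symmetric])
    then show ?thesis using Y2[OF k] by (auto simp: L2_def)
  qed
  have "(\<lambda>x. \<Sum>k\<le>2 * p. (2 * lam p - lam k) / 2 * ((X x)\<^sup>2 * Y k x)) \<in> L2 M"
    by (intro L2_sum L2_mult_left XY) simp
  then show "(\<lambda>x. (X x)\<^sup>2 * carre_du_champ L X X x) \<in> L2 M"
  proof (rule L2_AE_cong)
    show "AE x in M. (\<Sum>k\<le>2 * p. (2 * lam p - lam k) / 2 * ((X x)\<^sup>2 * Y k x)) =
        (X x)\<^sup>2 * carre_du_champ L X X x"
      using \<Gamma> by eventually_elim (simp add: sum_distrib_left mult_ac)
  qed simp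
qed

text \<open>
  The term \<open>L X\<^sup>2\<close> in \<open>2 \<Gamma>(X) = L X\<^sup>2 + 2 \<lambda> X\<^sup>2\<close> has mean zero.
\<close>

lemma (in markov_diffusion_generator) expectation_carre_du_champ:
  assumes X: "chaos_eigenfunction M D L lam p X"
  shows "expectation (carre_du_champ L X X) = lam p * moment M 2 X"
proof -
  note E = chaos_eigenfunction_eigenspace[OF X]
  note XD = eigenspace_dom[OF E] and XX = chaos_carre_du_champ_expansion(1)[OF X]
  have one: "(\<lambda>x. 1) \<in> L2 M" by (simp add: L2_def)
  have iL: "integrable M (L (\<lambda>x. X x * X x))"
    using L2_mult_integrable[OF range_L2[OF XX] one] by simp
  have i2: "integrable M (\<lambda>x. (X x)\<^sup>2)" using dom_L2[OF XD] by (simp add: L2_def)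
  have [measurable]: "X \<in> borel_measurable M" using dom_L2[OF XD] by (simp add: L2_def)
  have \<Gamma>: "AE x in M. carre_du_champ L X X x = L (\<lambda>x. X x * X x) x / 2 + lam p * (X x)\<^sup>2"
    using eigenspace_AE[OF E]
    by eventually_elim (simp add: carre_du_champ_def power2_eq_square field_simps)
  have "expectation (carre_du_champ L X X) =
      expectation (\<lambda>x. L (\<lambda>x. X x * X x) x / 2 + lam p * (X x)\<^sup>2)"
    by (rule integral_cong_AE)
       (use carre_du_champ_borel_measurable[OF XD XX] iL \<Gamma> in auto)
  also have "\<dots> = lam p * moment M 2 X"
    using iL i2 expectation_L[OF XX] by (simp add: moment_def)
  finally show ?thesis .
qed

text \<open>
  The test function \<open>x\<^sup>4\<close> yields \<open>12 E[X\<^sup>2 \<Gamma>(X)] = 4 \<lambda> E[X\<^sup>4]\<close>.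
\<close>

lemma (in markov_diffusion_generator) expectation_sq_carre_du_champ:
  assumes X: "chaos_eigenfunction M D L lam p X"
  shows "expectation (\<lambda>x. (X x)\<^sup>2 * carre_du_champ L X X x) = lam p / 3 * moment M 4 X"
proof -
  note E = chaos_eigenfunction_eigenspace[OF X]
  note XD = eigenspace_dom[OF E] and XX = chaos_carre_du_champ_expansion(1)[OF X]
  have [measurable]: "X \<in> borel_measurable M" "L X \<in> borel_measurable M"
    using dom_L2[OF XD] range_L2[OF XD] by (auto simp: L2_def)
  note G2 = carre_du_champ_L2[OF X]
  note [measurable] = carre_du_champ_borel_measurable[OF XD XX]
  let ?R = "\<lambda>x. deriv (\<lambda>x. x ^ 4) (X x) * L X x + deriv (deriv (\<lambda>x. x ^ 4)) (X x) * carre_du_champ L X X x"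
  let ?S = "\<lambda>x. (- 4 * lam p) * X x ^ 4 + 12 * ((X x)\<^sup>2 * carre_du_champ L X X x)"
  have d1: "deriv (\<lambda>x::real. x ^ 4) = (\<lambda>x. 4 * x ^ 3)"
    by (intro ext DERIV_imp_deriv) (auto intro!: derivative_eq_intros)
  have d2: "deriv (\<lambda>x::real. 4 * x ^ 3) = (\<lambda>x. 12 * x ^ 2)"
    by (intro ext DERIV_imp_deriv) (auto intro!: derivative_eq_intros)
  have SR: "AE x in M. ?S x = ?R x"
    unfolding d1 d2 using eigenspace_AE[OF E]
    by eventually_elim (simp add: power_numeral_reduce)
  have S2: "?S \<in> L2 M" by (intro L2_add L2_mult_left G2 eigenspace_power_L2[OF E])
  have R2: "?R \<in> L2 M"
    by (rule L2_AE_cong[OF S2 _ SR]) (simp add: d1 d2)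
  have "expectation ?R = 0"
    using diffusion_expectation[OF _ XD XX _ R2] eigenspace_power_L2[OF E]
    by (simp add: power4_eq_poly smooth_real_poly)
  moreover have "expectation ?S = expectation ?R"
    using S2 R2 SR by (intro integral_cong_AE) (auto simp: L2_def)
  moreover have "expectation ?S = - 4 * lam p * moment M 4 X +
      12 * expectation (\<lambda>x. (X x)\<^sup>2 * carre_du_champ L X X x)"
  proof -
    have "integrable M (\<lambda>x. X x ^ 4)" "integrable M (\<lambda>x. (X x)\<^sup>2 * carre_du_champ L X X x)"
      using L2_mult_integrable[OF eigenspace_power_L2[OF E, of 4], of "\<lambda>x. 1"]
        L2_mult_integrable[OF G2(2), of "\<lambda>x. 1"] by (auto simp: L2_def)
    then show ?thesis by (simp add: moment_def)
  qed
  ultimately show ?thesis by simp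
qed

text \<open>
  This is the one place where the spectral condition enters. It puts the coefficients \<open>c k\<close> of
  \<open>\<Gamma>(X)\<close> into \<open>[0, \<lambda>]\<close>, so that \<open>(c k)\<^sup>2 \<le> \<lambda> c k\<close>. By orthogonality the left-hand side is
  \<open>\<Sum> (c k)\<^sup>2 E[(Y k)\<^sup>2]\<close>, whereas \<open>E[X\<^sup>2 \<Gamma>(X)] = \<Sum> c k E[(Y k)\<^sup>2]\<close>.
\<close>

lemma (in markov_diffusion_generator) carre_du_champ_second_moment:
  assumes X: "chaos_eigenfunction M D L lam p X" and gap: "lam (2 * p) \<le> 2 * lam p"
  shows "expectation (\<lambda>x. (carre_du_champ L X X x)\<^sup>2) \<le>
         lam p * expectation (\<lambda>x. (X x)\<^sup>2 * carre_du_champ L X X x)"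
proof -
  note E = chaos_eigenfunction_eigenspace[OF X]
  note XD = eigenspace_dom[OF E] and XX = chaos_carre_du_champ_expansion(1)[OF X]
  obtain Y where Y: "\<And>k. k \<le> 2 * p \<Longrightarrow> Y k \<in> eigenspace M D L (lam k)"
    and sq: "AE x in M. (X x)\<^sup>2 = (\<Sum>k\<le>2 * p. Y k x)"
    and \<Gamma>: "AE x in M. carre_du_champ L X X x = (\<Sum>k\<le>2 * p. (2 * lam p - lam k) / 2 * Y k x)"
    using chaos_carre_du_champ_expansion(2)[OF X] by blast
  define c where "c k = (2 * lam p - lam k) / 2" for k
  note \<Gamma> = \<Gamma>[folded c_def]
  have [measurable]: "X \<in> borel_measurable M" using dom_L2[OF XD] by (simp add: L2_def)
  note [measurable] = carre_du_champ_borel_measurable[OF XD XX]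
  have Ym: "Y k \<in> borel_measurable M" if "k \<le> 2 * p" for k
    using dom_L2[OF eigenspace_dom[OF Y[OF that]]] by (simp add: L2_def)
  have meas: "(\<lambda>x. \<Sum>k\<le>2 * p. a k * Y k x) \<in> borel_measurable M" for a
    using Ym by (intro borel_measurable_sum) simp
  have c: "0 \<le> c k" "c k \<le> lam p" if "k \<le> 2 * p" for k
  proof -
    have "lam k \<le> lam (2 * p)" "lam 0 \<le> lam k"
      using that lam_strict_mono by (simp_all add: strict_mono_less_eq)
    then show "0 \<le> c k" "c k \<le> lam p" using gap lam_0 by (auto simp: c_def)
  qed
  have sq\<Gamma>: "AE x in M. (\<Sum>k\<le>2 * p. 1 * Y k x) * (\<Sum>k\<le>2 * p. c k * Y k x) =
      (X x)\<^sup>2 * carre_du_champ L X X x"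
    using sq \<Gamma> by eventually_elim simp
  have "expectation (\<lambda>x. (carre_du_champ L X X x)\<^sup>2) =
      expectation (\<lambda>x. (\<Sum>k\<le>2 * p. c k * Y k x) * (\<Sum>k\<le>2 * p. c k * Y k x))"
    by (rule integral_cong_AE) (use meas[of c] \<Gamma> in \<open>auto simp: power2_eq_square\<close>)
  also have "\<dots> = (\<Sum>k\<le>2 * p. c k * c k * expectation (\<lambda>x. (Y k x)\<^sup>2))"
    by (rule orthogonal_expansion[OF Y])
  also have "\<dots> \<le> (\<Sum>k\<le>2 * p. lam p * (1 * c k * expectation (\<lambda>x. (Y k x)\<^sup>2)))"
    unfolding mult_1_left mult.assoc[symmetric]
    by (intro sum_mono mult_right_mono) (use c in auto)
  also have "\<dots> = lam p * expectation (\<lambda>x. (\<Sum>k\<le>2 * p. 1 * Y k x) * (\<Sum>k\<le>2 * p. c k * Y k x))"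
    by (subst orthogonal_expansion[OF Y]) (simp_all only: sum_distrib_left)
  also have "expectation (\<lambda>x. (\<Sum>k\<le>2 * p. 1 * Y k x) * (\<Sum>k\<le>2 * p. c k * Y k x)) =
      expectation (\<lambda>x. (X x)\<^sup>2 * carre_du_champ L X X x)"
    by (rule integral_cong_AE)
       (use meas[of "\<lambda>_. 1"] meas[of c] sq\<Gamma> in auto)
  finally show ?thesis .
qed

text \<open>
  Expand the square and insert the values of \<open>E[\<Gamma>]\<close> and \<open>E[X\<^sup>2 \<Gamma>]\<close>. The combination
  \<open>m\<^sub>4 - 6 m\<^sub>2 + 3\<close> appears because the reference constant for \<open>\<Gamma>\<close> is \<open>\<lambda>\<close>, the value for unit
  variance, and not the mean \<open>\<lambda> m\<^sub>2\<close>.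
\<close>

lemma (in markov_diffusion_generator) fourth_moment_bound:
  assumes X: "chaos_eigenfunction M D L lam p X" and gap: "lam (2 * p) \<le> 2 * lam p"
    and pos: "lam p > 0"
  shows "expectation (\<lambda>x. (carre_du_champ L X X x / lam p - 1)\<^sup>2) \<le>
         (moment M 4 X - 6 * moment M 2 X + 3) / 3"
proof -
  let ?G = "carre_du_champ L X X"
  have G: "?G \<in> L2 M" by (rule carre_du_champ_L2[OF X])
  have i: "integrable M ?G" "integrable M (\<lambda>x. (?G x)\<^sup>2)"
    using L2_mult_integrable[OF G, of "\<lambda>x. 1"] G by (auto simp: L2_def)
  have "expectation (\<lambda>x. (?G x / lam p - 1)\<^sup>2) =
      expectation (\<lambda>x. (1 / (lam p)\<^sup>2) * (?G x)\<^sup>2 - (2 / lam p) * ?G x + 1)"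
    using pos by (intro Bochner_Integration.integral_cong)
      (auto simp: power2_eq_square field_simps)
  also have "\<dots> = (1 / (lam p)\<^sup>2) * expectation (\<lambda>x. (?G x)\<^sup>2) - (2 / lam p) * expectation ?G + 1"
    using i by (simp add: prob_space)
  also have "\<dots> \<le> (1 / (lam p)\<^sup>2) * (lam p * (lam p / 3 * moment M 4 X)) - (2 / lam p) * (lam p * moment M 2 X) + 1"
    using carre_du_champ_second_moment[OF X gap]
    unfolding expectation_carre_du_champ[OF X] expectation_sq_carre_du_champ[OF X]
    by (intro add_right_mono diff_right_mono mult_left_mono) auto
  also have "\<dots> = (moment M 4 X - 6 * moment M 2 X + 3) / 3"
    using pos by (simp add: power2_eq_square field_simps)
  finally show ?thesis .
qed

text \<open>
  The integrated diffusion identity for \<open>\<phi>(x) = a cos (t x) + b sin (t x)\<close>. Both derivatives of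
  \<open>\<phi>\<close> are bounded, which keeps the right-hand side of the diffusion identity square-integrable.
\<close>

lemma (in markov_diffusion_generator) trig_stein_identity:
  assumes X: "chaos_eigenfunction M D L lam p X"
  shows "lam p * expectation (\<lambda>x. X x * (t * (b * cos (t * X x) - a * sin (t * X x)))) =
         - expectation (\<lambda>x. carre_du_champ L X X x * (t\<^sup>2 * (a * cos (t * X x) + b * sin (t * X x))))"
proof -
  note E = chaos_eigenfunction_eigenspace[OF X]
  note XD = eigenspace_dom[OF E] and XX = chaos_carre_du_champ_expansion(1)[OF X]
  have [measurable]: "X \<in> borel_measurable M" "L X \<in> borel_measurable M"
    using dom_L2[OF XD] range_L2[OF XD] by (auto simp: L2_def)
  note [measurable] = carre_du_champ_borel_measurable[OF XD XX]
  let ?f = "\<lambda>x. a * cos (t * x) + b * sin (t * x)"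
  let ?f' = "\<lambda>x. b * t * cos (t * x) + - a * t * sin (t * x)"
  let ?f'' = "\<lambda>x. (- a * t) * t * cos (t * x) + - (b * t) * t * sin (t * x)"
  let ?R = "\<lambda>x. deriv ?f (X x) * L X x + deriv (deriv ?f) (X x) * carre_du_champ L X X x"
  let ?S = "\<lambda>x. ?f' (X x) * (- lam p * X x) + ?f'' (X x) * carre_du_champ L X X x"
  have bd: "\<bar>u * cos y + v * sin y\<bar> \<le> \<bar>u\<bar> + \<bar>v\<bar>" for u v y :: real
  proof -
    have "\<bar>u * cos y + v * sin y\<bar> \<le> \<bar>u\<bar> * \<bar>cos y\<bar> + \<bar>v\<bar> * \<bar>sin y\<bar>"
      by (metis abs_mult abs_triangle_ineq)
    also have "\<dots> \<le> \<bar>u\<bar> * 1 + \<bar>v\<bar> * 1"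
      by (intro add_mono mult_left_mono) auto
    finally show ?thesis by simp
  qed
  have SR: "AE x in M. ?S x = ?R x"
    unfolding deriv_trig using eigenspace_AE[OF E] by eventually_elim simp
  have S1: "(\<lambda>x. ?f' (X x) * (- lam p * X x)) \<in> L2 M"
    by (rule L2_bounded_mult[OF L2_mult_left[OF dom_L2[OF XD]] _ bd]) measurable
  have S2: "(\<lambda>x. ?f'' (X x) * carre_du_champ L X X x) \<in> L2 M"
    by (rule L2_bounded_mult[OF carre_du_champ_L2(1)[OF X] _ bd]) measurable
  note S = L2_add[OF S1 S2]
  have R: "?R \<in> L2 M"
    by (rule L2_AE_cong[OF S _ SR]) (unfold deriv_trig, measurable)
  have "(\<lambda>x. ?f (X x) * 1) \<in> L2 M"
    by (rule L2_bounded_mult[OF _ _ bd]) (simp add: L2_def, measurable)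
  then have f: "(\<lambda>x. ?f (X x)) \<in> L2 M" by simp
  have "expectation ?R = 0"
    by (rule diffusion_expectation[OF smooth_real_trig XD XX f R])
  moreover have "expectation ?S = expectation ?R"
    using S R SR by (intro integral_cong_AE) (auto simp: L2_def)
  moreover have "expectation ?S = expectation (\<lambda>x. ?f' (X x) * (- lam p * X x)) +
      expectation (\<lambda>x. ?f'' (X x) * carre_du_champ L X X x)"
    using L2_mult_integrable[OF S1, of "\<lambda>x. 1"] L2_mult_integrable[OF S2, of "\<lambda>x. 1"]
    by (intro Bochner_Integration.integral_add) (auto simp: L2_def)
  moreover have "expectation (\<lambda>x. ?f' (X x) * (- lam p * X x)) =
      - lam p * expectation (\<lambda>x. X x * (t * (b * cos (t * X x) - a * sin (t * X x))))"
    unfolding integral_mult_right_zero[symmetric]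
    by (intro Bochner_Integration.integral_cong) (auto simp: algebra_simps)
  moreover have "expectation (\<lambda>x. ?f'' (X x) * carre_du_champ L X X x) =
      - expectation (\<lambda>x. carre_du_champ L X X x * (t\<^sup>2 * (a * cos (t * X x) + b * sin (t * X x))))"
    unfolding Bochner_Integration.integral_minus[symmetric]
    by (intro Bochner_Integration.integral_cong) (auto simp: algebra_simps power2_eq_square)
  ultimately show ?thesis by simp
qed


text \<open>
  The two trigonometric identities combined into one for \<open>exp (i t x)\<close>, with a factor \<open>t\<close>
  cancelled. That cancellation is void at \<open>t = 0\<close>, where the claim says that \<open>X\<close> is centred; this
  holds because \<open>\<lambda> E[X] = - E[L X] = 0\<close>.
\<close>

lemma (in markov_diffusion_generator) complex_stein_identity:
  assumes X: "chaos_eigenfunction M D L lam p X" and pos: "lam p > 0"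
  shows "(\<integral>x. X x * iexp (t * X x) \<partial>M) =
         \<i> * t * (\<integral>x. (carre_du_champ L X X x / lam p) * iexp (t * X x) \<partial>M)"
proof (cases "t = 0")
  case True
  note E = chaos_eigenfunction_eigenspace[OF X]
  have "expectation (\<lambda>x. - lam p * X x) = expectation (L X)"
    using eigenspace_AE[OF E] dom_L2[OF eigenspace_dom[OF E]] range_L2[OF eigenspace_dom[OF E]]
    by (intro integral_cong_AE) (auto simp: L2_def)
  then have "expectation X = 0" using expectation_L[OF eigenspace_dom[OF E]] pos by simp
  then show ?thesis using True by simp
next
  case False
  note E = chaos_eigenfunction_eigenspace[OF X]
  note XD = eigenspace_dom[OF E] and XX = chaos_carre_du_champ_expansion(1)[OF X]
  let ?G = "\<lambda>x. carre_du_champ L X X x / lam p"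
  have [measurable]: "X \<in> borel_measurable M" using dom_L2[OF XD] by (simp add: L2_def)
  note [measurable] = carre_du_champ_borel_measurable[OF XD XX]
  have iX: "integrable M X" using L2_mult_integrable[OF dom_L2[OF XD], of "\<lambda>x. 1"] by (simp add: L2_def)
  have iG: "integrable M ?G"
    using L2_mult_integrable[OF carre_du_champ_L2(1)[OF X], of "\<lambda>x. 1"] by (simp add: L2_def)
  have iexp: "integrable M (\<lambda>x. Z x * iexp (t * X x))" if "integrable M Z" for Z :: "'a \<Rightarrow> real"
  proof (rule Bochner_Integration.integrable_bound[OF that])
    have [measurable]: "Z \<in> borel_measurable M" using that by auto
    show "(\<lambda>x. Z x * iexp (t * X x)) \<in> borel_measurable M" by measurable
  qed (auto simp: norm_mult)
  have Re_int: "Re (\<integral>x. Z x * iexp (t * X x) \<partial>M) = expectation (\<lambda>x. Z x * cos (t * X x))"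
    and Im_int: "Im (\<integral>x. Z x * iexp (t * X x) \<partial>M) = expectation (\<lambda>x. Z x * sin (t * X x))"
    if "integrable M Z" for Z :: "'a \<Rightarrow> real"
    using integral_Re[OF iexp[OF that]] integral_Im[OF iexp[OF that]] by (simp_all add: Re_exp Im_exp)
  have "t * (lam p * expectation (\<lambda>x. X x * sin (t * X x))) =
      t * (t * expectation (\<lambda>x. carre_du_champ L X X x * cos (t * X x)))"
    using trig_stein_identity[OF X, where t = t and a = 1 and b = 0]
    by (simp add: power2_eq_square mult_ac)
  then have s: "expectation (\<lambda>x. X x * sin (t * X x)) = t * expectation (\<lambda>x. ?G x * cos (t * X x))"
    using pos False by (simp add: field_simps)
  have "t * (lam p * expectation (\<lambda>x. X x * cos (t * X x))) =
      t * (- t * expectation (\<lambda>x. carre_du_champ L X X x * sin (t * X x)))"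
    using trig_stein_identity[OF X, where t = t and a = 0 and b = 1]
    by (simp add: power2_eq_square mult_ac)
  then have "lam p * expectation (\<lambda>x. X x * cos (t * X x)) =
      - t * expectation (\<lambda>x. carre_du_champ L X X x * sin (t * X x))"
    using False unfolding mult_cancel_left by simp
  then have c: "expectation (\<lambda>x. X x * cos (t * X x)) = - t * expectation (\<lambda>x. ?G x * sin (t * X x))"
    using pos False by (simp add: field_simps)
  have Re_it: "Re (\<i> * t * z) = - t * Im z" and Im_it: "Im (\<i> * t * z) = t * Re z" for z
    by simp_all
  show ?thesis
    by (rule complex_eqI) (simp_all only: Re_it Im_it Re_int[OF iX] Im_int[OF iX] Re_int[OF iG] Im_int[OF iG] c s)
qed

section \<open>Gaussian approximation of characteristic functions\<close>

text \<open>
  Differentiation under the integral sign. The second-order remainder of \<open>exp (i h X)\<close> is at most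
  \<open>(h X)\<^sup>2 / 2\<close>, so a finite second moment makes the difference quotients converge with rate \<open>h\<close>.
\<close>

lemma (in prob_space) iexp_expectation_has_vector_derivative:
  fixes X :: "'a \<Rightarrow> real"
  assumes [measurable]: "X \<in> borel_measurable M" and X: "integrable M X"
    and X2: "integrable M (\<lambda>x. (X x)\<^sup>2)"
  shows "((\<lambda>t. \<integral>x. iexp (t * X x) \<partial>M) has_vector_derivative
          (\<integral>x. \<i> * X x * iexp (t * X x) \<partial>M)) (at t)"
proof -
  define \<phi> where "\<phi> t = (\<integral>x. iexp (t * X x) \<partial>M)" for t
  define d where "d = (\<integral>x. \<i> * X x * iexp (t * X x) \<partial>M)"
  have i1: "integrable M (\<lambda>x. iexp (t * X x))" for t
    by (rule integrable_iexp) auto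
  have i2: "integrable M (\<lambda>x. \<i> * X x * iexp (t * X x))"
    by (rule Bochner_Integration.integrable_bound[OF X]) (auto simp: norm_mult)
  have bound: "norm (\<phi> (t + h) - \<phi> t - h *\<^sub>R d) / norm h \<le> \<bar>h\<bar> * (expectation (\<lambda>x. (X x)\<^sup>2) / 2)" for h
  proof -
    have pt: "norm (iexp ((t + h) * X x) - iexp (t * X x) - h * (\<i> * X x * iexp (t * X x)))
        \<le> h\<^sup>2 / 2 * (X x)\<^sup>2" for x
    proof -
      have "iexp ((t + h) * X x) - iexp (t * X x) - h * (\<i> * X x * iexp (t * X x)) =
        iexp (t * X x) * (iexp (h * X x) - (\<Sum>k\<le>1. (\<i> * (h * X x)) ^ k / fact k))"
        by (simp add: algebra_simps exp_add[symmetric])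
      also have "norm \<dots> = norm (iexp (h * X x) - (\<Sum>k\<le>1. (\<i> * (h * X x)) ^ k / fact k))"
        by (simp only: norm_mult norm_exp_i_times mult_1_left)
      also have "\<dots> \<le> \<bar>h * X x\<bar> ^ 2 / 2"
        using iexp_approx1[of "h * X x" 1] by (simp only: fact_2 Suc_1)
      finally show ?thesis by (simp add: power_mult_distrib)
    qed
    have "\<phi> (t + h) - \<phi> t - h *\<^sub>R d =
      (\<integral>x. (iexp ((t + h) * X x) - iexp (t * X x) - h * (\<i> * X x * iexp (t * X x))) \<partial>M)"
      unfolding \<phi>_def d_def scaleR_conv_of_real
      by (subst Bochner_Integration.integral_diff, (intro Bochner_Integration.integrable_diff integrable_mult_right i1 i2)+,
          subst Bochner_Integration.integral_diff, (intro i1)+, subst integral_mult_right_zero, rule refl)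
    also have "norm \<dots> \<le> (\<integral>x. h\<^sup>2 / 2 * (X x)\<^sup>2 \<partial>M)"
    proof (rule order_trans[OF integral_norm_bound integral_mono])
      show "integrable M (\<lambda>x. norm (iexp ((t + h) * X x) - iexp (t * X x) - h * (\<i> * X x * iexp (t * X x))))"
        by (intro integrable_norm Bochner_Integration.integrable_diff integrable_mult_right i1 i2)
    qed (use X2 pt in auto)
    also have "\<dots> = h\<^sup>2 * (expectation (\<lambda>x. (X x)\<^sup>2) / 2)" by simp
    finally have "norm (\<phi> (t + h) - \<phi> t - h *\<^sub>R d) \<le> h\<^sup>2 * (expectation (\<lambda>x. (X x)\<^sup>2) / 2)" .
    then show ?thesis
      by (cases "h = 0") (auto simp: pos_divide_le_eq power2_eq_square mult.assoc mult.commute mult.left_commute)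
  qed
  have "((\<lambda>h. \<bar>h\<bar> * (expectation (\<lambda>x. (X x)\<^sup>2) / 2)) \<longlongrightarrow> 0) (at 0)"
    by (auto intro!: tendsto_eq_intros)
  then have "((\<lambda>h. norm (\<phi> (t + h) - \<phi> t - h *\<^sub>R d) / norm h) \<longlongrightarrow> 0) (at 0)"
    by (rule Lim_null_comparison[rotated]) (use bound in \<open>auto intro!: always_eventually\<close>)
  then have "(\<phi> has_vector_derivative d) (at t)"
    unfolding has_vector_derivative_def has_derivative_at
    by (auto intro!: bounded_linear_intros)
  then show ?thesis unfolding \<phi>_def d_def .
qed

text \<open>
  The identity in the hypothesis says that the characteristic function satisfies
  \<open>\<phi>'(t) = - t \<phi>(t) - t e(t)\<close> with an error \<open>e(t) = E[(G - 1) exp (i t X)]\<close> of modulus at most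
  \<open>\<delta> = E\<bar>G - 1\<bar>\<close>. With the integrating factor \<open>exp (t\<^sup>2 / 2)\<close>, the function \<open>g = exp (t\<^sup>2 / 2) \<phi>\<close> has
  \<open>g 0 = 1\<close> and a derivative bounded by \<open>\<bar>t\<bar> exp (t\<^sup>2 / 2) \<delta>\<close> between \<open>0\<close> and \<open>t\<close>; the mean value
  inequality finishes the proof.
\<close>

lemma (in prob_space) char_near_gaussian_of_stein_identity:
  fixes X G :: "'a \<Rightarrow> real"
  assumes [measurable]: "X \<in> borel_measurable M" and X: "integrable M X"
    and X2: "integrable M (\<lambda>x. (X x)\<^sup>2)" and G: "integrable M G"
    and stein: "\<And>t. (\<integral>x. X x * iexp (t * X x) \<partial>M) = \<i> * t * (\<integral>x. G x * iexp (t * X x) \<partial>M)"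
  shows "cmod (char (distr M borel X) t - complex_of_real (exp (- t\<^sup>2 / 2))) \<le> t\<^sup>2 * expectation (\<lambda>x. \<bar>G x - 1\<bar>)"
proof -
  have [measurable]: "G \<in> borel_measurable M" using G by auto
  define \<phi> where "\<phi> t = (\<integral>x. iexp (t * X x) \<partial>M)" for t
  define \<delta> where "\<delta> = expectation (\<lambda>x. \<bar>G x - 1\<bar>)"
  define e where "e s = (\<integral>x. (G x - 1) * iexp (s * X x) \<partial>M)" for s
  have \<delta>0: "\<delta> \<ge> 0" unfolding \<delta>_def by simp
  have i1: "integrable M (\<lambda>x. iexp (s * X x))" for s
    by (rule integrable_iexp) auto
  have iG: "integrable M (\<lambda>x. G x * iexp (s * X x))" for s
    by (rule Bochner_Integration.integrable_bound[OF G]) (auto simp: norm_mult)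
  have e: "e s = (\<integral>x. G x * iexp (s * X x) \<partial>M) - \<phi> s" for s
    unfolding e_def \<phi>_def using i1 iG by (simp add: left_diff_distrib)
  have e_bound: "cmod (e s) \<le> \<delta>" for s
  proof -
    have "cmod (e s) \<le> (\<integral>x. cmod ((G x - 1) * iexp (s * X x)) \<partial>M)"
      unfolding e_def by (rule integral_norm_bound)
    also have "\<dots> = (\<integral>x. cmod (complex_of_real (G x - 1)) \<partial>M)" by (simp add: norm_mult)
    also have "\<dots> = \<delta>" unfolding \<delta>_def norm_of_real by simp
    finally show ?thesis .
  qed
  have d: "(\<phi> has_vector_derivative - s * \<phi> s - s * e s) (at s)" for s
  proof -
    have "(\<integral>x. \<i> * X x * iexp (s * X x) \<partial>M) = \<i> * (\<integral>x. X x * iexp (s * X x) \<partial>M)"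
      by (simp add: mult.assoc)
    also have "\<dots> = - s * \<phi> s - s * e s" unfolding stein e by (simp add: algebra_simps)
    finally show ?thesis
      using iexp_expectation_has_vector_derivative[OF assms(1) X X2, of s] unfolding \<phi>_def by simp
  qed
  define g where "g s = exp (s\<^sup>2 / 2) *\<^sub>R \<phi> s" for s :: real
  have dg: "(g has_vector_derivative - (s * exp (s\<^sup>2 / 2)) *\<^sub>R e s) (at s)" for s
  proof -
    have "((\<lambda>s::real. exp (s\<^sup>2 / 2)) has_field_derivative s * exp (s\<^sup>2 / 2)) (at s)"
      by (auto intro!: derivative_eq_intros)
    from has_vector_derivative_scaleR[OF this d]
    have "(g has_vector_derivative exp (s\<^sup>2 / 2) *\<^sub>R (- s * \<phi> s - s * e s) + (s * exp (s\<^sup>2 / 2)) *\<^sub>R \<phi> s) (at s)"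
      unfolding g_def by simp
    then show ?thesis by (simp add: algebra_simps scaleR_conv_of_real)
  qed
  have "norm (g t - g 0) \<le> \<bar>t\<bar> * exp (t\<^sup>2 / 2) * \<delta> * norm (t - 0)"
  proof (rule differentiable_bound[where S = "{- \<bar>t\<bar>..\<bar>t\<bar>}"])
    fix s assume s: "s \<in> {- \<bar>t\<bar>..\<bar>t\<bar>}"
    show "(g has_derivative (\<lambda>h. h *\<^sub>R (- (s * exp (s\<^sup>2 / 2)) *\<^sub>R e s))) (at s within {- \<bar>t\<bar>..\<bar>t\<bar>})"
      using dg[of s] unfolding has_vector_derivative_def by (rule has_derivative_at_withinI)
    have st: "\<bar>s\<bar> \<le> \<bar>t\<bar>" using s by auto
    then have "s\<^sup>2 \<le> t\<^sup>2" by (simp add: abs_le_square_iff)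
    then have "norm (- (s * exp (s\<^sup>2 / 2)) *\<^sub>R e s) \<le> \<bar>t\<bar> * exp (t\<^sup>2 / 2) * \<delta>"
      using st e_bound[of s] by (auto simp: abs_mult intro!: mult_mono)
    then show "onorm (\<lambda>h. h *\<^sub>R (- (s * exp (s\<^sup>2 / 2)) *\<^sub>R e s)) \<le> \<bar>t\<bar> * exp (t\<^sup>2 / 2) * \<delta>"
      by (subst onorm_scaleR_left) (auto simp: onorm_id bounded_linear_ident)
  qed auto
  moreover have "g 0 = 1" by (simp add: g_def \<phi>_def prob_space)
  ultimately have gt: "norm (g t - 1) \<le> exp (t\<^sup>2 / 2) * (t\<^sup>2 * \<delta>)"
    by (simp add: power2_eq_square mult_ac)
  have "\<phi> t - exp (- t\<^sup>2 / 2) = exp (- t\<^sup>2 / 2) *\<^sub>R (g t - 1)"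
    unfolding g_def by (simp add: algebra_simps scaleR_conv_of_real exp_minus field_simps)
  then have "cmod (\<phi> t - exp (- t\<^sup>2 / 2)) = exp (- t\<^sup>2 / 2) * norm (g t - 1)"
    by (simp only: norm_scaleR abs_exp_cancel)
  also have "\<dots> \<le> exp (- t\<^sup>2 / 2) * (exp (t\<^sup>2 / 2) * (t\<^sup>2 * \<delta>))"
    by (rule mult_left_mono[OF gt]) simp
  also have "\<dots> = t\<^sup>2 * \<delta>" by (simp add: mult.assoc[symmetric] exp_add[symmetric])
  finally have "cmod (\<phi> t - exp (- t\<^sup>2 / 2)) \<le> t\<^sup>2 * \<delta>" .
  moreover have "char (distr M borel X) t = \<phi> t"
    unfolding char_def \<phi>_def by (subst integral_distr) auto
  ultimately show ?thesis unfolding \<delta>_def by simp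
qed

section \<open>Convergence of moments\<close>

text \<open>
  Bounded second moments of \<open>f\<close> make it uniformly integrable: the truncation \<open>min f K\<close> is bounded
  and continuous, and \<open>f - min f K \<le> f\<^sup>2 / K\<close> makes the truncation error small uniformly along
  the sequence.
\<close>

lemma weak_conv_imp_integral_conv:
  fixes \<mu> :: "nat \<Rightarrow> real measure" and \<nu> :: "real measure" and f :: "real \<Rightarrow> real"
  assumes \<mu>: "\<And>n. real_distribution (\<mu> n)" and \<nu>: "real_distribution \<nu>"
    and weak: "weak_conv_m \<mu> \<nu>"
    and f: "\<And>x. isCont f x" "\<And>x. f x \<ge> 0"
    and int: "\<And>n. integrable (\<mu> n) (\<lambda>x. (f x)\<^sup>2)" "integrable \<nu> (\<lambda>x. (f x)\<^sup>2)"
    and bound: "\<And>n. (\<integral>x. (f x)\<^sup>2 \<partial>\<mu> n) \<le> C"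
  shows "(\<lambda>n. \<integral>x. f x \<partial>\<mu> n) \<longlonglongrightarrow> (\<integral>x. f x \<partial>\<nu>)"
proof (rule LIMSEQ_I)
  fix r :: real assume r: "r > 0"
  have [measurable]: "f \<in> borel_measurable borel"
    using f(1) by (auto intro!: borel_measurable_continuous_onI continuous_at_imp_continuous_on)
  define B where "B = max 1 (max C (\<integral>x. (f x)\<^sup>2 \<partial>\<nu>))"
  \<comment> \<open>cutting at this level makes each of the two truncation errors at most \<open>r / 4\<close>\<close>
  define K where "K = 4 * B / r"
  have B: "B \<ge> 1" "C \<le> B" "(\<integral>x. (f x)\<^sup>2 \<partial>\<nu>) \<le> B" unfolding B_def by auto
  have K: "K > 0" "B / K = r / 4" using B r unfolding K_def by auto
  have cut: "\<bar>(\<integral>x. f x \<partial>\<rho>) - (\<integral>x. min (f x) K \<partial>\<rho>)\<bar> \<le> r / 4"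
    if \<rho>: "real_distribution \<rho>" and i: "integrable \<rho> (\<lambda>x. (f x)\<^sup>2)" and b: "(\<integral>x. (f x)\<^sup>2 \<partial>\<rho>) \<le> B" for \<rho>
  proof -
    interpret \<rho>: real_distribution \<rho> by fact
    have iK: "integrable \<rho> (\<lambda>x. min (f x) K)"
      by (rule \<rho>.integrable_const_bound[where B = K]) (use f(2) K in \<open>auto simp: min_def\<close>)
    have pt: "\<bar>f x - min (f x) K\<bar> \<le> (f x)\<^sup>2 / K" for x
    proof (cases "f x \<le> K")
      case False
      then have "f x * K \<le> f x * f x" using K f(2)[of x] by (intro mult_left_mono) auto
      then have "f x \<le> (f x)\<^sup>2 / K" using K by (simp add: pos_le_divide_eq power2_eq_square)
      then show ?thesis using False K by (simp add: min_def)
    qed (use K in simp)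
    have iD: "integrable \<rho> (\<lambda>x. f x - min (f x) K)"
      by (rule Bochner_Integration.integrable_bound[of _ "\<lambda>x. (f x)\<^sup>2 / K"]) (use pt i K in auto)
    have "integrable \<rho> f" using Bochner_Integration.integrable_add[OF iD iK] by simp
    then have "\<bar>(\<integral>x. f x \<partial>\<rho>) - (\<integral>x. min (f x) K \<partial>\<rho>)\<bar> = \<bar>\<integral>x. f x - min (f x) K \<partial>\<rho>\<bar>"
      using iK by simp
    also have "\<dots> \<le> (\<integral>x. (f x)\<^sup>2 / K \<partial>\<rho>)"
      unfolding real_norm_def[symmetric]
      by (rule order_trans[OF integral_norm_bound integral_mono]) (use iD pt i in auto)
    also have "\<dots> \<le> B / K" using b K by (simp add: divide_right_mono)
    finally show ?thesis using K by simp
  qed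
  have "(\<lambda>n. \<integral>x. min (f x) K \<partial>\<mu> n) \<longlonglongrightarrow> (\<integral>x. min (f x) K \<partial>\<nu>)"
  proof (rule weak_conv_imp_integral_bdd_continuous_conv[OF \<mu> \<nu> weak])
    fix x
    show "isCont (\<lambda>x. min (f x) K) x" by (intro continuous_min continuous_const f(1))
    show "norm (min (f x) K) \<le> K" using f(2)[of x] K by (simp add: min_def)
  qed
  from LIMSEQ_D[OF this, of "r / 4"] r obtain N where
    N: "\<bar>(\<integral>x. min (f x) K \<partial>\<mu> n) - (\<integral>x. min (f x) K \<partial>\<nu>)\<bar> < r / 4" if "n \<ge> N" for n by auto
  have "norm ((\<integral>x. f x \<partial>\<mu> n) - (\<integral>x. f x \<partial>\<nu>)) < r" if "n \<ge> N" for n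
    using N[OF that] cut[OF \<mu> int(1) order_trans[OF bound B(2)], of n] cut[OF \<nu> int(2) B(3)] r
    unfolding real_norm_def by linarith
  then show "\<exists>N. \<forall>n\<ge>N. norm ((\<integral>x. f x \<partial>\<mu> n) - (\<integral>x. f x \<partial>\<nu>)) < r" by blast
qed

section \<open>The fourth moment theorem\<close>

theorem corollary3p3:
  fixes M :: "'a measure"
    and D :: "('a \<Rightarrow> real) set"
    and L :: "('a \<Rightarrow> real) \<Rightarrow> ('a \<Rightarrow> real)"
    and lam :: "nat \<Rightarrow> real"
    and p :: nat
    and X :: "nat \<Rightarrow> 'a \<Rightarrow> real"
  assumes "markov_diffusion_generator M D L lam"
    and "p \<ge> 1"
    and "\<And>n. chaos_eigenfunction M D L lam p (X n)"
    and "bounded_in_Lr M 2 X"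
    and "lam (2 * p) \<le> 2 * lam p"
  shows "weak_conv_m (\<lambda>n. distr M borel (X n)) std_normal_distribution \<longleftrightarrow>
         (\<lambda>n. moment M 4 (X n) - 6 * moment M 2 (X n) + 3) \<longlonglongrightarrow> 0"
proof -
  interpret markov_diffusion_generator M D L lam by fact
  note X = assms(3) and gap = assms(5)
  note E = chaos_eigenfunction_eigenspace[OF X]
  have pos: "lam p > 0"
    using strict_monoD[OF lam_strict_mono, of 0 p] assms(2) lam_0 by simp
  have XL2: "X n \<in> L2 M" for n using dom_L2[OF eigenspace_dom[OF E]] .
  have [measurable]: "X n \<in> borel_measurable M" for n using XL2[of n] by (simp add: L2_def)
  have distr: "real_distribution (distr M borel (X n))" for n by simp
  show ?thesis
  proof
    assume weak: "weak_conv_m (\<lambda>n. distr M borel (X n)) std_normal_distribution"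
    \<comment> \<open>even powers have bounded second moments by hypercontractivity, applied with exponent \<open>4 j\<close>\<close>
    have moments: "(\<lambda>n. moment M (2 * j) (X n)) \<longlonglongrightarrow> (\<integral>x. x ^ (2 * j) \<partial>std_normal_distribution)"
      if j: "j \<ge> 1" for j
    proof -
      have pw: "\<bar>y\<bar> powr real (4 * j) = (y ^ (2 * j))\<^sup>2" for y :: real
      proof -
        have "\<bar>y\<bar> powr real (4 * j) = \<bar>y\<bar> ^ (4 * j)" using j by (intro powr_realpow') auto
        also have "\<dots> = (y ^ (2 * j))\<^sup>2" by (simp add: power_even_abs power_mult[symmetric])
        finally show ?thesis .
      qed
      have "bounded_in_Lr M (real (4 * j)) X"
        using hypercontractive E assms(4) j unfolding hypercontractive_def by fastforce
      then obtain C where C: "\<And>n. integrable M (\<lambda>x. (X n x ^ (2 * j))\<^sup>2)"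
        "\<And>n. expectation (\<lambda>x. (X n x ^ (2 * j))\<^sup>2) \<le> C"
        unfolding bounded_in_Lr_def pw by blast
      have "(\<lambda>n. \<integral>x. x ^ (2 * j) \<partial>distr M borel (X n)) \<longlonglongrightarrow> (\<integral>x. x ^ (2 * j) \<partial>std_normal_distribution)"
      proof (rule weak_conv_imp_integral_conv[OF distr real_dist_normal_dist weak])
        show "integrable std_normal_distribution (\<lambda>x. (x ^ (2 * j))\<^sup>2)"
          unfolding power_mult[symmetric] by (rule integrable_std_normal_distribution_moment)
        show "integrable (distr M borel (X n)) (\<lambda>x. (x ^ (2 * j))\<^sup>2)" for n
          using C(1)[of n] by (subst integrable_distr_eq) auto
        show "(\<integral>x. (x ^ (2 * j))\<^sup>2 \<partial>distr M borel (X n)) \<le> C" for n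
          using C(2)[of n] by (subst integral_distr) auto
      qed auto
      moreover have "(\<integral>x. x ^ (2 * j) \<partial>distr M borel (X n)) = moment M (2 * j) (X n)" for n
        unfolding moment_def by (subst integral_distr) auto
      ultimately show ?thesis by simp
    qed
    have m2: "(\<lambda>n. moment M 2 (X n)) \<longlonglongrightarrow> 1"
      using moments[of 1] std_normal_distribution_even_moments(1)[of 1] by (simp add: fact_2)
    have "(\<integral>x. x ^ (2 * 2) \<partial>std_normal_distribution) = 3"
      unfolding std_normal_distribution_even_moments(1) by (simp add: fact_numeral)
    then have m4: "(\<lambda>n. moment M 4 (X n)) \<longlonglongrightarrow> 3" using moments[of 2] by simp
    have "(\<lambda>n. moment M 4 (X n) - 6 * moment M 2 (X n) + 3) \<longlonglongrightarrow> 3 - 6 * 1 + 3"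
      by (intro tendsto_intros m2 m4)
    then show "(\<lambda>n. moment M 4 (X n) - 6 * moment M 2 (X n) + 3) \<longlonglongrightarrow> 0" by simp
  next
    assume mom: "(\<lambda>n. moment M 4 (X n) - 6 * moment M 2 (X n) + 3) \<longlonglongrightarrow> 0"
    define q where "q n = sqrt ((moment M 4 (X n) - 6 * moment M 2 (X n) + 3) / 3)" for n
    have "(\<lambda>n. (moment M 4 (X n) - 6 * moment M 2 (X n) + 3) / 3) \<longlonglongrightarrow> 0"
      using tendsto_divide[OF mom tendsto_const[of 3]] by simp
    from tendsto_real_sqrt[OF this] have q: "q \<longlonglongrightarrow> 0" unfolding q_def by simp
    have bound: "cmod (char (distr M borel (X n)) t - complex_of_real (exp (- t\<^sup>2 / 2))) \<le> t\<^sup>2 * q n"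
      for n t
    proof -
      let ?G = "\<lambda>x. carre_du_champ L (X n) (X n) x / lam p"
      have one: "(\<lambda>x. c) \<in> L2 M" for c by (simp add: L2_def)
      have GL2: "?G \<in> L2 M"
        using L2_mult_left[OF carre_du_champ_L2(1)[OF X], of "1 / lam p"] by simp
      have iG: "integrable M ?G" and iX: "integrable M (X n)"
        using L2_mult_integrable[OF GL2 one[of 1]] L2_mult_integrable[OF XL2 one[of 1]] by simp_all
      have G1: "(\<lambda>x. ?G x - 1) \<in> L2 M" using L2_add[OF GL2 one[of "- 1"]] by simp
      have "cmod (char (distr M borel (X n)) t - complex_of_real (exp (- t\<^sup>2 / 2)))
          \<le> t\<^sup>2 * expectation (\<lambda>x. \<bar>?G x - 1\<bar>)"
        by (rule char_near_gaussian_of_stein_identity[OF _ iX _ iG complex_stein_identity[OF X pos]])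
           (use XL2[of n] in \<open>auto simp: L2_def\<close>)
      also have "\<dots> \<le> t\<^sup>2 * q n"
      proof (rule mult_left_mono)
        have "expectation (\<lambda>x. \<bar>?G x - 1\<bar>) \<le> sqrt (expectation (\<lambda>x. (?G x - 1)\<^sup>2))"
          by (rule expectation_abs_le_sqrt[OF G1])
        also have "\<dots> \<le> q n"
          unfolding q_def by (intro real_sqrt_le_mono fourth_moment_bound[OF X gap pos])
        finally show "expectation (\<lambda>x. \<bar>?G x - 1\<bar>) \<le> q n" .
      qed simp
      finally show ?thesis .
    qed
    show "weak_conv_m (\<lambda>n. distr M borel (X n)) std_normal_distribution"
    proof (rule levy_continuity[OF distr real_dist_normal_dist])
      fix t
      have "(\<lambda>n. t\<^sup>2 * q n) \<longlonglongrightarrow> 0" using tendsto_mult_left[OF q, of "t\<^sup>2"] by simp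
      then have "(\<lambda>n. char (distr M borel (X n)) t - complex_of_real (exp (- t\<^sup>2 / 2))) \<longlonglongrightarrow> 0"
        by (rule Lim_null_comparison[rotated]) (use bound in simp)
      then show "(\<lambda>n. char (distr M borel (X n)) t) \<longlonglongrightarrow> char std_normal_distribution t"
        unfolding char_std_normal_distribution by (rule LIM_zero_cancel)
    qed
  qed
qed

end
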